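(* Let $C_r$ denote the Chebyshev polynomials defined in the context. Throughout $t$ and $a$ are rational numbers different from $0,\pm1,\pm2$. (1) For a prime $r$, the equation $C_r(t)=\pm C_r(a)$ (i.e. $C_r(t)=C_r(a)$ or $C_r(t)=-C_r(a)$) has a rational solution $(t,a)$ with $t\neq\pm a$ if and only if $r=2$ or $r=3$. (2) The equation $C_2(t)=-C_2(a)$ is equivalent to $t^2+a^2=4$. (3) Given $t$, the equation $C_3(t)=C_3(a)$ is solvable in rational $a\ne t$ if and only if $t^2-4=-3f^2$ for some rational $f$, and then the solutions are $a=\frac{-t\pm3f}{2}$.
   Context: For $t\in\mathbb Q$ let $D_t=\begin{pmatrix}0&-1\\1&t\end{pmatrix}$. The Chebyshev polynomials of the first kind (in the normalization used here) are $C_n(t)=\operatorname{tr}D_t^n$; equivalently $C_0=2$, $C_1(t)=t$, $C_{n+1}(t)=tC_n(t)-C_{n-1}(t)$. *)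

theory Defs
  imports "HOL-Analysis.Analysis" "HOL-Computational_Algebra.Polynomial"
begin

definition D :: "rat \<Rightarrow> rat^2^2" where
  "D t = vector [vector [0, -1], vector [1, t]]"

definition D_pow :: "rat \<Rightarrow> nat \<Rightarrow> rat^2^2" where
  "D_pow t n = ((\<lambda>M. D t ** M) ^^ n) (mat 1)"

(* Normalised so that C_n(x + 1/x) = x^n + 1/x^n, i.e. C_n(2 x) = 2 T_n(x) for the
   classical Chebyshev polynomials T_n. *)
fun chebC :: "nat \<Rightarrow> rat poly" where
  "chebC 0 = [:2:]"
| "chebC (Suc 0) = [:0, 1:]"
| "chebC (Suc (Suc n)) = [:0, 1:] * chebC (Suc n) - chebC n"

definition admissible :: "rat \<Rightarrow> bool" where
  "admissible t \<longleftrightarrow> t \<notin> {0, 1, -1, 2, -2}"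

lemma D_pow_0: "D_pow t 0 = mat 1"
  by (simp add: D_pow_def)

lemma D_pow_Suc: "D_pow t (Suc n) = D t ** D_pow t n"
  by (simp add: D_pow_def)

lemma poly_chebC_eq_trace: "poly (chebC n) t = trace (D_pow t n)"
proof (induction n rule: chebC.induct)
  case 1
  show ?case by (simp add: D_pow_0 trace_def sum_2 mat_def)
next
  case 2
  show ?case
    by (simp add: D_pow_0 D_pow_Suc D_def trace_def sum_2)
next
  case (3 n)
  have "trace (D_pow t (Suc (Suc n))) = t * trace (D_pow t (Suc n)) - trace (D_pow t n)"
    by (simp add: D_pow_Suc D_def trace_def sum_2 matrix_matrix_mult_def algebra_simps)
  with 3 show ?case by simp
qed

end

theory Submission
  imports Defs
begin

text \<open>
  For \<open>r = 2\<close> and \<open>r = 3\<close> everything is explicit algebra: \<open>C\<^sub>2(X) = X\<^sup>2 - 2\<close> and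
  \<open>C\<^sub>3(X) = X\<^sup>3 - 3 X\<close>. The content is that no prime \<open>r \<ge> 5\<close> admits a solution.

  Since \<open>C\<^sub>r\<close> is then odd, a sign can be moved into \<open>a\<close>, so let \<open>C\<^sub>r(t) = C\<^sub>r(a)\<close> with
  \<open>t \<noteq> \<plusminus>a\<close>. Writing \<open>t = x + 1/x\<close> and \<open>a = y + 1/y\<close> over the complex numbers, the relation
  \<open>C\<^sub>r(x + 1/x) = x\<^sup>r + 1/x\<^sup>r\<close> gives \<open>x\<^sup>r = y\<^sup>r\<close> or \<open>x\<^sup>r = 1/y\<^sup>r\<close>; in the second case replace \<open>y\<close>
  by \<open>1/y\<close>. So \<open>x = z y\<close> with \<open>z\<^sup>r = 1\<close>, and \<open>c = z + 1/z\<close> satisfies \<open>C\<^sub>r(c) = 2\<close> as well as the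
  rational quadratic equation
  \<open>c\<^sup>2 - t a c + (t\<^sup>2 + a\<^sup>2 - 4) = 0\<close> (\<open>root_quotient_trace\<close>).

  If \<open>c\<close> is rational, it is an algebraic integer of absolute value at most \<open>2\<close>, hence
  one of \<open>0, \<plusminus>1, \<plusminus>2\<close>. In each case \<open>z\<^bsup>12\<^esup> = 1\<close>, so \<open>z = 1\<close> because \<open>r\<close> is coprime
  to \<open>12\<close>; but then \<open>t = a\<close>.

  If \<open>c\<close> is irrational, the quadratic polynomial \<open>Q\<close> above is its minimal polynomial and divides
  \<open>C\<^sub>r - 2\<close>. Two things follow. By Gauss's lemma (\<open>monic_factor_integral\<close>) \<open>Q\<close> has integer
  coefficients, so \<open>t a\<close> and \<open>t\<^sup>2 + a\<^sup>2\<close> are integers, and this forces \<open>t\<close> and \<open>a\<close> themselves to be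
  integers (\<open>integral_of_product_and_square_sum\<close>). Moreover the second root
  \<open>t a - c\<close> of \<open>Q\<close> is again a root of \<open>C\<^sub>r - 2\<close>, hence of the form \<open>w + 1/w\<close> with \<open>w\<^sup>r = 1\<close>, so both
  roots have absolute value at most \<open>2\<close> and \<open>\<bar>t a\<bar> \<le> 4\<close>. As \<open>t\<close> and \<open>a\<close> are integers different
  from \<open>0, \<plusminus>1, \<plusminus>2\<close>, also \<open>\<bar>t a\<bar> \<ge> 9\<close>, a contradiction.
\<close>

section \<open>Coefficientwise ring homomorphisms\<close>

lemma map_poly_hom_add:
  assumes "h 0 = 0" "\<And>x y. h (x + y) = h x + h y"
  shows "map_poly h (p + q) = map_poly h p + map_poly h q"
  by (intro poly_eqI) (simp add: coeff_map_poly assms)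

lemma map_poly_hom_mult:
  fixes h :: "'a::comm_semiring_0 \<Rightarrow> 'b::comm_semiring_0"
  assumes h: "h 0 = 0" "\<And>x y. h (x + y) = h x + h y" "\<And>x y. h (x * y) = h x * h y"
  shows "map_poly h (p * q) = map_poly h p * map_poly h q"
proof (induction p)
  case (pCons c p)
  have "map_poly h (pCons c p * q) = smult (h c) (map_poly h q) + pCons 0 (map_poly h (p * q))"
    by (simp add: mult_pCons_left map_poly_hom_add map_poly_smult map_poly_pCons h)
  then show ?case
    by (simp add: pCons.IH map_poly_pCons h)
qed auto

text \<open>
  Evaluation of a rational polynomial at a complex point; this is the common ground on which
  the rational numbers \<open>t\<close>, \<open>a\<close> meet the roots of unity.
\<close>
definition cpoly :: "rat poly \<Rightarrow> complex \<Rightarrow> complex" where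
  "cpoly p x = poly (map_poly of_rat p) x"

lemma cpoly_pCons [simp]: "cpoly (pCons c p) x = of_rat c + x * cpoly p x"
  by (simp add: cpoly_def map_poly_pCons)

lemma cpoly_0 [simp]: "cpoly 0 x = 0"
  by (simp add: cpoly_def)

lemma cpoly_add: "cpoly (p + q) x = cpoly p x + cpoly q x"
  by (simp add: cpoly_def map_poly_hom_add of_rat_add)

lemma cpoly_mult: "cpoly (p * q) x = cpoly p x * cpoly q x"
  by (simp add: cpoly_def map_poly_hom_mult of_rat_add of_rat_mult)

lemma cpoly_diff: "cpoly (p - q) x = cpoly p x - cpoly q x"
  using cpoly_add[of "p - q" q x] by simp

lemma cpoly_of_rat: "cpoly p (of_rat t) = of_rat (poly p t)"
  by (induction p) (simp_all add: of_rat_add of_rat_mult)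


section \<open>Gauss's lemma for monic factors\<close>

lemma clear_denominators:
  fixes p :: "rat poly"
  obtains d :: int and q :: "int poly" where "d > 0" "smult (of_int d) p = map_poly of_int q"
proof -
  have "\<exists>d q. d > (0::int) \<and> smult (of_int d) p = map_poly of_int q"
  proof (induction p)
    case 0
    show ?case by (rule exI[of _ 1], rule exI[of _ 0]) simp
  next
    case (pCons c p)
    then obtain d q where dq: "d > (0::int)" "smult (of_int d) p = map_poly of_int q"
      by blast
    obtain u v where uv: "quotient_of c = (u, v)" by fastforce
    then have v: "v > 0" and c: "c = of_int u / of_int v"
      using quotient_of_denom_pos quotient_of_div by auto
    have "smult (of_int (v * d)) (pCons c p) = map_poly of_int (pCons (d * u) (smult v q))"
      using v by (simp add: c map_poly_pCons map_poly_smult flip: dq(2))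
    with v dq(1) show ?case
      by (intro exI[of _ "v * d"] exI) auto
  qed
  with that show ?thesis by blast
qed

text \<open>
  Clear denominators in both factors with multipliers \<open>d\<close> and \<open>e\<close>. The contents of the resulting
  integer polynomials divide their leading coefficients \<open>d\<close> and \<open>e\<close>, and
  multiply to \<open>d e\<close>, because the product is \<open>d e\<close> times a monic integer polynomial. So \<open>d\<close> is the content of the first one and can be
  cancelled again.
\<close>
lemma monic_factor_integral:
  fixes f g :: "rat poly"
  assumes f: "lead_coeff f = 1" and g: "lead_coeff g = 1"
    and int: "\<And>i. coeff (f * g) i \<in> \<int>"
  shows "coeff f i \<in> \<int>"
proof -
  obtain d p where d: "d > 0" and p: "smult (of_int d) f = map_poly of_int p"
    by (rule clear_denominators)
  obtain e q where e: "e > 0" and q: "smult (of_int e) g = map_poly of_int q"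
    by (rule clear_denominators)
  obtain h :: "int poly" where h: "f * g = map_poly of_int h"
    using int by (rule intpolyE)
  have lead: "lead_coeff (map_poly of_int u :: rat poly) = of_int (lead_coeff u)" for u
    by (simp add: coeff_map_poly degree_map_poly)
  have "lead_coeff h = 1"
    using lead[of h] f g by (simp add: lead_coeff_mult flip: h)
  then have ch: "content h = 1"
    by (metis content_dvd_coeff is_unit_normalize normalize_content)
  have "of_int (lead_coeff p) = (of_int d :: rat)"
    using lead[of p] f d by (simp flip: p split: if_splits)
  then have lp: "content p dvd d"
    by (metis content_dvd_coeff of_int_eq_iff)
  have "of_int (lead_coeff q) = (of_int e :: rat)"
    using lead[of q] g e by (simp flip: q split: if_splits)
  then have lq: "content q dvd e"
    by (metis content_dvd_coeff of_int_eq_iff)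
  have "map_poly of_int (p * q) = (map_poly of_int (smult (d * e) h) :: rat poly)"
    by (simp add: map_poly_hom_mult map_poly_smult mult_ac flip: p q h)
  then have "p * q = smult (d * e) h"
    by (auto simp: poly_eq_iff coeff_map_poly simp flip: of_int_mult)
  then have "content p * content q = d * e"
    using d e by (metis abs_of_pos ch content_mult content_smult mult.right_neutral
        mult_pos_pos normalize_int_def)
  moreover obtain k where k: "d = content p * k" using lp by blast
  moreover obtain l where l: "e = content q * l" using lq by blast
  ultimately have "k * l = 1"
    using d e by (auto simp: mult.assoc mult.left_commute)
  then have "d dvd content p"
    using k by (metis dvd_refl mult_unit_dvd_iff' mult.commute dvd_triv_left)
  then have "d dvd coeff p i"
    using content_dvd_coeff dvd_trans by blast
  moreover have "of_int d * coeff f i = of_int (coeff p i)"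
    using arg_cong[OF p, of "\<lambda>u. coeff u i"] by (simp add: coeff_map_poly)
  ultimately show ?thesis
    using d by auto
qed

lemma rat_algebraic_int_in_Ints:
  fixes x :: rat
  assumes "lead_coeff p = 1" "\<forall>i. coeff p i \<in> \<int>" "poly p x = 0"
  shows "x \<in> \<int>"
proof -
  have "x \<in> \<rat>" by (metis Rats_of_rat of_rat_eq_id id_apply)
  with algebraic_int.intros[OF assms] show ?thesis
    by (rule rational_algebraic_int_is_int)
qed

text \<open>
  The number \<open>t\<close> is a root of the monic polynomial
  \<open>(X\<^sup>2 - t\<^sup>2) (X\<^sup>2 - a\<^sup>2) = X\<^sup>4 - (t\<^sup>2 + a\<^sup>2) X\<^sup>2 + (t a)\<^sup>2\<close>.
\<close>
lemma integral_of_product_and_square_sum: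
  fixes t a :: rat
  assumes "t * a \<in> \<int>" "t\<^sup>2 + a\<^sup>2 \<in> \<int>"
  shows "t \<in> \<int>"
proof (rule rat_algebraic_int_in_Ints)
  let ?p = "[:(t * a)\<^sup>2, 0, - (t\<^sup>2 + a\<^sup>2), 0, 1:]"
  show "lead_coeff ?p = 1" by simp
  have "(t * a)\<^sup>2 \<in> \<int>" "- (t\<^sup>2 + a\<^sup>2) \<in> \<int>"
    using assms by (simp_all only: Ints_power Ints_minus)
  then show "\<forall>i. coeff ?p i \<in> \<int>"
    by (auto simp: coeff_pCons simp del: minus_add_distrib split: nat.splits)
  show "poly ?p t = 0"
    by (simp add: algebra_simps power2_eq_square)
qed


section \<open>Chebyshev polynomials and roots of unity\<close>

lemma cpoly_chebC:
  assumes "x \<noteq> 0"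
  shows "cpoly (chebC n) (x + inverse x) = x ^ n + inverse x ^ n"
proof (induction n rule: chebC.induct)
  case (3 n)
  with assms show ?case
    by (simp add: cpoly_diff cpoly_mult field_simps)
qed simp_all

lemma coeff_chebC_in_Ints: "coeff (chebC n) i \<in> \<int>"
proof (induction n arbitrary: i rule: chebC.induct)
  case (3 n)
  then show ?case by (auto simp: coeff_pCons split: nat.splits)
qed (auto simp: coeff_pCons split: nat.splits)

text \<open>
  The degree of \<open>C\<^sub>n\<close> is carried along in the induction so that \<open>X C\<^sub>n\<^sub>+\<^sub>1\<close> is seen to dominate \<open>C\<^sub>n\<close> in
  the recurrence.
\<close>
lemma chebC_monic:
  "degree (chebC (Suc n)) = Suc n \<and> lead_coeff (chebC (Suc n)) = 1 \<and> degree (chebC n) = n"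
proof (induction n)
  case (Suc n)
  let ?p = "[:0, 1:] * chebC (Suc n)"
  have "chebC (Suc n) \<noteq> 0" using Suc by auto
  then have deg: "degree ?p = Suc (Suc n)"
    using Suc by (simp add: degree_mult_eq)
  have lt: "degree (- chebC n) < degree ?p" using Suc deg by simp
  have eq: "chebC (Suc (Suc n)) = ?p + - chebC n" by simp
  have "degree (chebC (Suc (Suc n))) = Suc (Suc n)"
    unfolding eq using degree_add_eq_left[OF lt] deg by simp
  moreover have "lead_coeff (chebC (Suc (Suc n))) = 1"
    unfolding eq using lead_coeff_add_le[of "- chebC n" ?p] lt Suc
    by (metis add.commute lead_coeff_mult lead_coeff_pCons(1)
        lead_coeff_1 mult_1 one_neq_zero one_pCons)
  ultimately show ?case using Suc by blast
qed simp

lemma chebC_minus_2_integral_monic: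
  assumes "n > 0"
  shows "lead_coeff (chebC n - [:2:]) = 1" "\<forall>i. coeff (chebC n - [:2:]) i \<in> \<int>"
proof -
  obtain m where m: "n = Suc m" using assms gr0_conv_Suc by blast
  have lt: "degree (- [:2 :: rat:]) < degree (chebC n)"
    using chebC_monic[of m] m by simp
  have "lead_coeff (chebC n) = 1"
    using chebC_monic[of m] unfolding m by blast
  then have "lead_coeff (chebC n + - [:2:]) = 1"
    using lead_coeff_add_le[OF lt] by (simp only: add.commute)
  then show "lead_coeff (chebC n - [:2:]) = 1"
    by (simp only: add_uminus_conv_diff)
  show "\<forall>i. coeff (chebC n - [:2:]) i \<in> \<int>"
    by (auto simp: coeff_chebC_in_Ints coeff_pCons split: nat.splits)
qed

lemma poly_chebC_minus: "poly (chebC n) (- x) = (- 1) ^ n * poly (chebC n) x"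
proof (induction n rule: chebC.induct)
  case (3 n)
  then show ?case by (simp add: algebra_simps)
qed simp_all

lemma ex_plus_inverse:
  fixes w :: complex
  obtains x where "x \<noteq> 0" "w = x + inverse x"
proof -
  define x where "x = (w + csqrt (w\<^sup>2 - 4)) / 2"
  have "x * (w - x) = (w\<^sup>2 - (csqrt (w\<^sup>2 - 4))\<^sup>2) / 4"
    by (simp add: x_def field_simps power2_eq_square)
  then have "x * (w - x) = 1" by simp
  then have "x \<noteq> 0" "w = x + inverse x"
    by (auto simp: inverse_unique)
  with that show ?thesis .
qed

text \<open>
  If \<open>w = x + 1/x\<close>, the equation \<open>C\<^sub>n(w) = 2\<close> reads \<open>(x\<^sup>n - 1)\<^sup>2 = 0\<close>.
\<close>
lemma chebC_eq_2D:
  assumes "cpoly (chebC n) w = 2"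
  obtains x where "x ^ n = 1" "x \<noteq> 0" "w = x + inverse x"
proof -
  obtain x where x: "x \<noteq> 0" "w = x + inverse x" by (rule ex_plus_inverse)
  with assms have "x ^ n + inverse (x ^ n) = 2"
    by (simp add: cpoly_chebC power_inverse)
  then have "(x ^ n - 1)\<^sup>2 = 0"
    using x by (simp add: field_simps power2_eq_square)
  with x that show ?thesis by simp
qed

lemma norm_chebC_eq_2:
  assumes "cpoly (chebC n) w = 2" "n > 0"
  shows "norm w \<le> 2"
proof -
  obtain x where x: "x ^ n = 1" "w = x + inverse x"
    using assms(1) by (rule chebC_eq_2D)
  have "norm x ^ n = 1" using x by (metis norm_one norm_power)
  then have "norm x = 1"
    using \<open>n > 0\<close> power_eq_imp_eq_base[of "norm x" n 1] by simp
  then have "norm x + norm (inverse x) = 2"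
    by (simp add: norm_inverse)
  with x show ?thesis by (metis norm_triangle_ineq)
qed

lemma root_of_unity_coprime_orders:
  fixes z :: complex
  assumes "z ^ m = 1" "z ^ n = 1" "coprime m n" "m \<noteq> 0"
  shows "z = 1"
proof -
  obtain u v where "m * u = n * v + 1"
    using bezout_nat[OF assms(4), of n] assms(3) by (auto simp: coprime_iff_gcd_eq_1)
  then have "(z ^ m) ^ u = (z ^ n) ^ v * z"
    by (simp flip: power_mult add: mult.commute)
  with assms show ?thesis by simp
qed

text \<open>
  The values \<open>-2, -1, 0, 1\<close> of \<open>x + 1/x\<close> belong to roots of unity \<open>x\<close> of order \<open>2, 3, 4, 6\<close>, all of
  which divide \<open>12\<close>.
\<close>
lemma rational_root_of_chebC_minus_2:
  fixes q :: rat
  assumes root: "poly (chebC n) q = 2" and n: "coprime n 12" "n > 0"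
  shows "q = 2"
proof -
  have root': "cpoly (chebC n) (of_rat q) = 2"
    using root by (simp add: cpoly_of_rat)
  have "poly (chebC n - [:2:]) q = 0"
    using root by simp
  then have "q \<in> \<int>"
    using chebC_minus_2_integral_monic[OF n(2)] rat_algebraic_int_in_Ints by blast
  then obtain k where k: "q = of_int k" by (rule Ints_cases)
  have "norm (of_int k :: complex) \<le> 2"
    using norm_chebC_eq_2[OF root' n(2)] k by simp
  then have "\<bar>k\<bar> \<le> 2" by simp
  then consider "k = -2" | "k = -1" | "k = 0" | "k = 1" | "k = 2" by linarith
  note small_trace = this
  obtain x :: complex where x: "x ^ n = 1" "x \<noteq> 0" "of_rat q = x + inverse x"
    using root' by (rule chebC_eq_2D)
  have quad: "x ^ 2 = of_int k * x - 1"
    using x k by (simp add: field_simps power2_eq_square)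
  have "x ^ 3 = x * x ^ 2"
    by (simp add: power2_eq_square power3_eq_cube)
  also have "\<dots> = of_int k * x ^ 2 - x"
    by (subst quad) (simp add: algebra_simps power2_eq_square)
  also have "\<dots> = (of_int k ^ 2 - 1) * x - of_int k"
    unfolding quad by (simp add: algebra_simps power2_eq_square)
  finally have cube: "x ^ 3 = (of_int k ^ 2 - 1) * x - of_int k" .
  have twelve: ?thesis if "x ^ 12 = 1"
  proof -
    have "x = 1" using root_of_unity_coprime_orders[of x n 12] x(1) that n by simp
    with x(3) have "of_rat q = (of_rat 2 :: complex)" by simp
    then show ?thesis by (simp only: of_rat_eq_iff)
  qed
  from small_trace show ?thesis
  proof cases
    case 1
    then have "(x + 1) ^ 2 = 0" using quad by (simp add: power2_sum)
    then have "x = -1" by (simp add: add_eq_0_iff2)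
    then show ?thesis by (intro twelve) simp
  next
    case 2
    then have "x ^ 3 = 1"
      using cube by simp
    then have "(x ^ 3) ^ 4 = 1" by simp
    then show ?thesis by (intro twelve) (simp flip: power_mult)
  next
    case 3
    then have "(x ^ 2) ^ 6 = 1" using quad by simp
    then show ?thesis by (intro twelve) (simp flip: power_mult)
  next
    case 4
    then have "x ^ 3 = - 1"
      using cube by simp
    then have "(x ^ 3) ^ 4 = 1" by simp
    then show ?thesis by (intro twelve) (simp flip: power_mult)
  qed (simp add: k)
qed


section \<open>No solutions for exponents coprime to 12\<close>

text \<open>
  With \<open>t = x + 1/x\<close> and \<open>a = y + 1/y\<close> the number \<open>c = x/y + y/x\<close> is the trace of a root of unity.
  Its conjugate under \<open>y \<mapsto> 1/y\<close> is \<open>x y + 1/(x y)\<close>, with sum \<open>t a\<close> and product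
  \<open>t\<^sup>2 + a\<^sup>2 - 4\<close>; this is where the quadratic equation comes from.
\<close>
lemma root_quotient_trace:
  fixes t a :: complex
  assumes "cpoly (chebC n) t = cpoly (chebC n) a"
  obtains c where "cpoly (chebC n) c = 2" "c\<^sup>2 - t * a * c + (t\<^sup>2 + a\<^sup>2 - 4) = 0"
proof -
  obtain x where x: "x \<noteq> 0" "t = x + inverse x" by (rule ex_plus_inverse)
  obtain y' where y': "y' \<noteq> 0" "a = y' + inverse y'" by (rule ex_plus_inverse)
  have "x ^ n + inverse (x ^ n) = y' ^ n + inverse (y' ^ n)"
    using assms x y' by (simp add: cpoly_chebC power_inverse)
  then have "(x ^ n - y' ^ n) * (x ^ n * y' ^ n - 1) = 0"
    using x y' by (simp add: field_simps)
  then have "x ^ n = y' ^ n \<or> x ^ n = inverse y' ^ n"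
    using y' by (auto simp: power_inverse nonzero_eq_divide_eq simp flip: divide_inverse
        intro: inverse_unique[symmetric] simp: mult.commute)
  then obtain y where y: "y \<noteq> 0" "a = y + inverse y" "x ^ n = y ^ n"
    using y' by (metis add.commute inverse_inverse_eq inverse_nonzero_iff_nonzero)
  let ?z = "x / y"
  show ?thesis
  proof
    have "?z \<noteq> 0" "?z ^ n = 1" using x y by (simp_all add: power_divide)
    then show "cpoly (chebC n) (?z + inverse ?z) = 2"
      by (subst cpoly_chebC) (simp_all add: power_inverse del: inverse_divide)
    show "(?z + inverse ?z)\<^sup>2 - t * a * (?z + inverse ?z) + (t\<^sup>2 + a\<^sup>2 - 4) = 0"
      unfolding x(2) y(2) using x(1) y(1) by (simp add: field_simps power2_eq_square)
  qed
qed

text \<open>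
  The remainder of \<open>f\<close> modulo the quadratic polynomial is a rational polynomial of degree at most
  \<open>1\<close> that vanishes at the irrational number \<open>c\<close>, so it is zero.
\<close>
lemma quadratic_dvd_of_irrational_root:
  fixes f :: "rat poly"
  assumes root: "cpoly f c = 0" "cpoly [:p, s, 1:] c = 0" and irr: "\<And>q. c \<noteq> of_rat q"
  shows "[:p, s, 1:] dvd f"
proof -
  let ?Q = "[:p, s, 1:]"
  define R where "R = f mod ?Q"
  have "f = f div ?Q * ?Q + R" unfolding R_def by (rule div_mult_mod_eq[symmetric])
  then have "cpoly R c = 0"
    using root by (metis add_0 cpoly_add cpoly_mult mult_zero_right)
  moreover have "degree R < 2"
    using degree_mod_less[of ?Q f] by (auto simp: R_def)
  then have R: "R = [:coeff R 0, coeff R 1:]"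
    by (intro poly_eqI) (auto simp: coeff_pCons coeff_eq_0 split: nat.splits)
  ultimately have lin: "of_rat (coeff R 0) + c * of_rat (coeff R 1) = 0"
    by (metis cpoly_pCons cpoly_0 mult_zero_right add_0_right)
  have "coeff R 1 = 0"
  proof (rule ccontr)
    assume nz: "coeff R 1 \<noteq> 0"
    with lin have "c = of_rat (- coeff R 0 / coeff R 1)"
      by (simp add: of_rat_divide of_rat_minus field_simps add_eq_0_iff)
    with irr show False by blast
  qed
  with lin have "R = 0" by (subst R) simp
  then show ?thesis by (simp add: R_def dvd_eq_mod_eq_0)
qed

lemma admissible_int_abs_ge_3:
  assumes "admissible t" "t = of_int k"
  shows "\<bar>k\<bar> \<ge> 3"
proof (rule ccontr)
  assume "\<not> \<bar>k\<bar> \<ge> 3"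
  then have "k = 0 \<or> k = 1 \<or> k = -1 \<or> k = 2 \<or> k = -2" by linarith
  with assms show False by (auto simp: admissible_def)
qed

lemma chebC_eq_imp_eq:
  assumes adm: "admissible t" "admissible a"
    and n: "coprime n 12" "n > 0"
    and eq: "poly (chebC n) t = poly (chebC n) a"
  shows "t = a"
proof -
  obtain c where c: "cpoly (chebC n) c = 2"
    and quad: "c\<^sup>2 - of_rat t * of_rat a * c + ((of_rat t)\<^sup>2 + (of_rat a)\<^sup>2 - 4) = 0"
    using root_quotient_trace[of n "of_rat t" "of_rat a"] eq by (auto simp: cpoly_of_rat)
  show ?thesis
  proof (cases "\<exists>q. c = of_rat q")
    case True
    then obtain q where q: "c = of_rat q" by blast
    with c have "of_rat (poly (chebC n) q) = (of_rat 2 :: complex)"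
      by (simp add: cpoly_of_rat)
    then have "q = 2"
      using n rational_root_of_chebC_minus_2 by (simp only: of_rat_eq_iff)
    with quad q have "(of_rat t - of_rat a :: complex)\<^sup>2 = 0"
      by (simp add: power2_eq_square algebra_simps)
    then show ?thesis by simp
  next
    case False
    define Q where "Q = [:t\<^sup>2 + a\<^sup>2 - 4, - (t * a), 1:]"
    define f where "f = chebC n - [:2:]"
    have "cpoly f c = 0" using c by (simp add: f_def cpoly_diff)
    moreover have "cpoly Q c = 0"
      using quad by (simp add: Q_def of_rat_add of_rat_diff of_rat_minus of_rat_mult of_rat_power
          power2_eq_square algebra_simps)
    ultimately have "Q dvd f"
      unfolding Q_def using False by (intro quadratic_dvd_of_irrational_root) auto
    then obtain G where G: "f = Q * G" by blast
    have "lead_coeff f = 1"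
      unfolding f_def by (rule chebC_minus_2_integral_monic[OF n(2)])
    moreover have lQ: "lead_coeff Q = 1" by (simp add: Q_def)
    ultimately have "lead_coeff G = 1"
      by (simp add: G lead_coeff_mult)
    moreover have "coeff (Q * G) i \<in> \<int>" for i
      unfolding G[symmetric] f_def using chebC_minus_2_integral_monic[OF n(2)] by blast
    ultimately have int: "coeff Q i \<in> \<int>" for i
      by (rule monic_factor_integral[OF lQ])
    have "t * a \<in> \<int>"
      using int[of 1] by (simp add: Q_def)
    moreover have "t\<^sup>2 + a\<^sup>2 \<in> \<int>"
      using Ints_add[OF int[of 0], of 4] by (simp add: Q_def)
    ultimately have "t \<in> \<int>" "a \<in> \<int>"
      using integral_of_product_and_square_sum[of t a] integral_of_product_and_square_sum[of a t]
      by (simp_all only: mult.commute[of a t] add.commute[of "a\<^sup>2" "t\<^sup>2"])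
    then obtain k l where kl: "t = of_int k" "a = of_int l"
      by (auto elim!: Ints_cases)
    then have kl3: "\<bar>k\<bar> \<ge> 3" "\<bar>l\<bar> \<ge> 3"
      using adm admissible_int_abs_ge_3 by auto
    \<comment> \<open>the second root of \<open>Q\<close>\<close>
    define c' where "c' = of_rat (t * a) - c"
    have "cpoly Q c' = 0"
      using quad by (simp add: c'_def Q_def of_rat_add of_rat_diff of_rat_minus of_rat_mult
          of_rat_power power2_eq_square algebra_simps)
    then have "cpoly f c' = 0" by (simp add: G cpoly_mult)
    then have "cpoly (chebC n) c' = 2" by (simp add: f_def cpoly_diff)
    then have "norm c' \<le> 2" "norm c \<le> 2"
      using c n(2) norm_chebC_eq_2 by blast+
    then have "norm (c + c') \<le> 4"
      using norm_triangle_ineq[of c c'] by linarith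
    moreover have "c + c' = of_int (k * l)"
      by (simp add: c'_def kl of_rat_mult)
    ultimately have "norm (of_int (k * l) :: complex) \<le> 4" by simp
    then have "\<bar>k * l\<bar> \<le> 4" by (simp only: norm_of_int)
    moreover have "3 * 3 \<le> \<bar>k\<bar> * \<bar>l\<bar>"
      using kl3 by (intro mult_mono) auto
    ultimately show ?thesis by (simp add: abs_mult)
  qed
qed

lemma prime_coprime_12:
  fixes r :: nat
  assumes "prime r" "r \<noteq> 2" "r \<noteq> 3"
  shows "coprime r 12"
proof -
  have "coprime r 2" "coprime r 3"
    using assms primes_coprime[of r 2] primes_coprime[of r 3] by auto
  then have "coprime r (2 * 2 * 3)"
    by (simp only: coprime_mult_right_iff)
  then show ?thesis by simp
qed

lemma chebC_eq_pm_prime: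
  assumes r: "prime r" "r \<noteq> 2" "r \<noteq> 3"
    and adm: "admissible t" "admissible a"
    and eq: "poly (chebC r) t = poly (chebC r) a \<or> poly (chebC r) t = - poly (chebC r) a"
  shows "t = a \<or> t = - a"
proof -
  have cop: "coprime r 12" "r > 0"
    using r prime_coprime_12 by (auto simp: prime_gt_0_nat)
  have "odd r" using r prime_odd_nat prime_ge_2_nat[of r] by auto
  then have "poly (chebC r) (- a) = - poly (chebC r) a"
    by (simp add: poly_chebC_minus)
  moreover have "admissible (- a)"
    using adm by (auto simp: admissible_def minus_equation_iff[of a])
  ultimately show ?thesis
    using chebC_eq_imp_eq[OF adm cop] chebC_eq_imp_eq[OF adm(1) _ cop, of "- a"] eq by auto
qed


section \<open>The exponents 2 and 3\<close>

lemma poly_chebC_2: "poly (chebC 2) t = t\<^sup>2 - 2"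
  by (simp add: numeral_2_eq_2 power2_eq_square)

lemma poly_chebC_3: "poly (chebC 3) t = t ^ 3 - 3 * t"
  by (simp add: numeral_3_eq_3 power3_eq_cube algebra_simps)

lemma rat_square_neq_3: "(t::rat)\<^sup>2 \<noteq> 3"
proof
  assume t: "t\<^sup>2 = 3"
  have "t \<in> \<int>"
  proof (rule rat_algebraic_int_in_Ints)
    show "lead_coeff [:- 3, 0, 1 :: rat:] = 1" by simp
    show "\<forall>i. coeff [:- 3, 0, 1 :: rat:] i \<in> \<int>"
      by (auto simp: coeff_pCons split: nat.splits)
    show "poly [:- 3, 0, 1:] t = 0" using t by (simp add: power2_eq_square)
  qed
  then obtain k where "t = of_int k" by (rule Ints_cases)
  with t have "of_int (k\<^sup>2) = (of_int 3 :: rat)" by simp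
  then have k: "k\<^sup>2 = 3" by (simp only: of_int_eq_iff)
  then have "\<bar>k\<bar> < 2" using abs_le_square_iff[of 2 k] by (intro notI[THEN not_le_imp_less]) auto
  then have "k = 0 \<or> k = 1 \<or> k = -1" by linarith
  with k show False by auto
qed

text \<open>
  Dividing \<open>C\<^sub>3(t) - C\<^sub>3(a)\<close> by \<open>t - a\<close> leaves a conic whose discriminant with respect to \<open>a\<close> is
  \<open>-3 (t\<^sup>2 - 4)\<close>.
\<close>
lemma chebC_3_eq_iff:
  assumes "a \<noteq> t"
  shows "poly (chebC 3) t = poly (chebC 3) a \<longleftrightarrow> t\<^sup>2 + t * a + a\<^sup>2 = 3"
proof -
  have "poly (chebC 3) t - poly (chebC 3) a = (t - a) * (t\<^sup>2 + t * a + a\<^sup>2 - 3)"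
    by (simp add: poly_chebC_3 power2_eq_square power3_eq_cube algebra_simps)
  with assms show ?thesis
    by (metis eq_iff_diff_eq_0 mult_eq_0_iff)
qed

text \<open>
  On the conic \<open>t\<^sup>2 + t a + a\<^sup>2 = 3\<close> the exceptional values \<open>a = t\<close> and \<open>a = 0, \<plusminus>1, \<plusminus>2\<close>
  are only taken at \<open>t \<in> {\<plusminus>1, \<plusminus>2}\<close> or \<open>t\<^sup>2 = 3\<close>.
\<close>
lemma conic_admissible:
  assumes t: "admissible t" and conic: "t\<^sup>2 + t * a + a\<^sup>2 = 3"
  shows "admissible a \<and> a \<noteq> t"
proof -
  have t': "t \<noteq> 0" "t - 1 \<noteq> 0" "t + 1 \<noteq> 0" "t - 2 \<noteq> 0" "t + 2 \<noteq> 0"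
    using t by (auto simp: admissible_def add_eq_0_iff2)
  have "a \<noteq> t"
  proof
    assume "a = t"
    with conic have "(t - 1) * (t + 1) = 0" by (simp add: power2_eq_square algebra_simps)
    with t' show False by simp
  qed
  moreover have "a \<noteq> 0" using conic rat_square_neq_3[of t] by auto
  moreover have "a \<noteq> 1"
  proof
    assume "a = 1"
    with conic have "(t - 1) * (t + 2) = 0" by (simp add: power2_eq_square algebra_simps)
    with t' show False by simp
  qed
  moreover have "a \<noteq> -1"
  proof
    assume "a = -1"
    with conic have "(t + 1) * (t - 2) = 0" by (simp add: power2_eq_square algebra_simps)
    with t' show False by simp
  qed
  moreover have "a \<noteq> 2"
  proof
    assume "a = 2"
    with conic have "(t + 1) * (t + 1) = 0" by (simp add: power2_eq_square algebra_simps)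
    with t' show False by simp
  qed
  moreover have "a \<noteq> -2"
  proof
    assume "a = -2"
    with conic have "(t - 1) * (t - 1) = 0" by (simp add: power2_eq_square algebra_simps)
    with t' show False by simp
  qed
  ultimately show ?thesis by (auto simp: admissible_def)
qed

lemma conic_solutions:
  fixes t a f :: rat
  assumes f: "t\<^sup>2 - 4 = - 3 * f\<^sup>2"
  shows "t\<^sup>2 + t * a + a\<^sup>2 = 3 \<longleftrightarrow> a = (- t + 3 * f) / 2 \<or> a = (- t - 3 * f) / 2"
proof -
  have "4 * (t\<^sup>2 + t * a + a\<^sup>2 - 3) = (2 * a + t - 3 * f) * (2 * a + t + 3 * f)"
    using f by (simp add: power2_eq_square algebra_simps)
  then have "t\<^sup>2 + t * a + a\<^sup>2 = 3 \<longleftrightarrow> 2 * a + t - 3 * f = 0 \<or> 2 * a + t + 3 * f = 0"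
    by (metis eq_iff_diff_eq_0 mult_eq_0_iff zero_neq_numeral)
  also have "\<dots> \<longleftrightarrow> a = (- t + 3 * f) / 2 \<or> a = (- t - 3 * f) / 2"
    by (auto simp: field_simps)
  finally show ?thesis .
qed

lemma chebC_3_solutions:
  assumes "admissible t" "t\<^sup>2 - 4 = - 3 * f\<^sup>2"
  shows "{a. admissible a \<and> a \<noteq> t \<and> poly (chebC 3) t = poly (chebC 3) a}
           = {(- t + 3 * f) / 2, (- t - 3 * f) / 2}"
proof -
  have "admissible a \<and> a \<noteq> t \<and> poly (chebC 3) t = poly (chebC 3) a
      \<longleftrightarrow> a = (- t + 3 * f) / 2 \<or> a = (- t - 3 * f) / 2" for a
    using chebC_3_eq_iff[of a t] conic_admissible[OF assms(1), of a] conic_solutions[OF assms(2), of a]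
    by argo
  then show ?thesis
    by (simp only: set_eq_iff mem_Collect_eq insert_iff empty_iff simp_thms)
qed

lemma chebC_3_solvable_iff:
  assumes t: "admissible t"
  shows "(\<exists>a. admissible a \<and> a \<noteq> t \<and> poly (chebC 3) t = poly (chebC 3) a)
           \<longleftrightarrow> (\<exists>f. t\<^sup>2 - 4 = - 3 * f\<^sup>2)"
proof
  assume "\<exists>a. admissible a \<and> a \<noteq> t \<and> poly (chebC 3) t = poly (chebC 3) a"
  then obtain a where "t\<^sup>2 + t * a + a\<^sup>2 = 3" using chebC_3_eq_iff by blast
  then have "t\<^sup>2 - 4 = - 3 * ((t + 2 * a) / 3)\<^sup>2"
    by (simp add: power2_eq_square field_simps)
  then show "\<exists>f. t\<^sup>2 - 4 = - 3 * f\<^sup>2" ..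
next
  assume "\<exists>f. t\<^sup>2 - 4 = - 3 * f\<^sup>2"
  then show "\<exists>a. admissible a \<and> a \<noteq> t \<and> poly (chebC 3) t = poly (chebC 3) a"
    using chebC_3_solutions[OF t] by blast
qed

text \<open>
  A rational point of \<open>t\<^sup>2 + a\<^sup>2 = 4\<close> for \<open>r = 2\<close>, coming from \<open>3\<^sup>2 + 4\<^sup>2 = 5\<^sup>2\<close>, and one of the conic
  \<open>t\<^sup>2 + t a + a\<^sup>2 = 3\<close> for \<open>r = 3\<close>, coming from \<open>t\<^sup>2 - 4 = -3 f\<^sup>2\<close> with \<open>f = 3/7\<close>, that is
  from \<open>13\<^sup>2 + 3 \<cdot> 3\<^sup>2 = 14\<^sup>2\<close>.
\<close>
lemma chebC_2_3_witness:
  assumes "r = 2 \<or> r = 3"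
  shows "\<exists>t a. admissible t \<and> admissible a \<and> t \<noteq> a \<and> t \<noteq> - a \<and>
           (poly (chebC r) t = poly (chebC r) a \<or> poly (chebC r) t = - poly (chebC r) a)"
  using assms
proof
  assume "r = 2"
  then show ?thesis
    by (rule_tac x = "6/5" in exI, rule_tac x = "8/5" in exI)
      (simp add: admissible_def poly_chebC_2 power2_eq_square)
next
  assume "r = 3"
  then show ?thesis
    by (rule_tac x = "13/7" in exI, rule_tac x = "-2/7" in exI)
      (simp add: admissible_def poly_chebC_3 power3_eq_cube)
qed

theorem lemma9:
  shows
    "(\<forall>r::nat. prime r \<longrightarrow>
        ((\<exists>t a. admissible t \<and> admissible a \<and> t \<noteq> a \<and> t \<noteq> - a \<and>
            (poly (chebC r) t = poly (chebC r) a \<or> poly (chebC r) t = - poly (chebC r) a))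
         \<longleftrightarrow> r = 2 \<or> r = 3))
     \<and> (\<forall>t a. admissible t \<and> admissible a \<longrightarrow>
        (poly (chebC 2) t = - poly (chebC 2) a \<longleftrightarrow> t^2 + a^2 = 4))
     \<and> (\<forall>t. admissible t \<longrightarrow>
        ((\<exists>a. admissible a \<and> a \<noteq> t \<and> poly (chebC 3) t = poly (chebC 3) a)
           \<longleftrightarrow> (\<exists>f::rat. t^2 - 4 = - 3 * f^2))
        \<and> (\<forall>f::rat. t^2 - 4 = - 3 * f^2 \<longrightarrow>
             {a. admissible a \<and> a \<noteq> t \<and> poly (chebC 3) t = poly (chebC 3) a}
               = {(- t + 3 * f) / 2, (- t - 3 * f) / 2}))"
proof (intro conjI allI impI)
  fix r :: nat
  assume r: "prime r"
  show "(\<exists>t a. admissible t \<and> admissible a \<and> t \<noteq> a \<and> t \<noteq> - a \<and>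
      (poly (chebC r) t = poly (chebC r) a \<or> poly (chebC r) t = - poly (chebC r) a))
    \<longleftrightarrow> r = 2 \<or> r = 3"
  proof
    assume "\<exists>t a. admissible t \<and> admissible a \<and> t \<noteq> a \<and> t \<noteq> - a \<and>
        (poly (chebC r) t = poly (chebC r) a \<or> poly (chebC r) t = - poly (chebC r) a)"
    then obtain t a where "admissible t" "admissible a" "t \<noteq> a" "t \<noteq> - a"
      "poly (chebC r) t = poly (chebC r) a \<or> poly (chebC r) t = - poly (chebC r) a"
      by (elim exE conjE)
    then show "r = 2 \<or> r = 3"
      using chebC_eq_pm_prime[OF r, of t a] by argo
  next
    assume "r = 2 \<or> r = 3"
    then show "\<exists>t a. admissible t \<and> admissible a \<and> t \<noteq> a \<and> t \<noteq> - a \<and>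
        (poly (chebC r) t = poly (chebC r) a \<or> poly (chebC r) t = - poly (chebC r) a)"
      by (rule chebC_2_3_witness)
  qed
next
  fix t a :: rat
  show "poly (chebC 2) t = - poly (chebC 2) a \<longleftrightarrow> t^2 + a^2 = 4"
    by (auto simp: poly_chebC_2)
next
  fix t :: rat
  assume t: "admissible t"
  show "(\<exists>a. admissible a \<and> a \<noteq> t \<and> poly (chebC 3) t = poly (chebC 3) a)
      \<longleftrightarrow> (\<exists>f::rat. t^2 - 4 = - 3 * f^2)"
    by (rule chebC_3_solvable_iff[OF t])
  fix f :: rat
  assume "t^2 - 4 = - 3 * f^2"
  then show "{a. admissible a \<and> a \<noteq> t \<and> poly (chebC 3) t = poly (chebC 3) a}
      = {(- t + 3 * f) / 2, (- t - 3 * f) / 2}"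
    by (rule chebC_3_solutions[OF t])
qed

end
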